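(* Let $S$ be a $*$-monoid and let $a\in S$ satisfy $(a^{2})^{*}=a^{2}$. Then the following conditions are equivalent: (1) $a$ is left core invertible; (2) $a$ is right core invertible; (3) $a$ is EP.
   Context: A $*$-monoid is a monoid $S$ with an involution, i.e. a map $*:S\to S$ with $(a^{*})^{*}=a$ and $(ab)^{*}=b^{*}a^{*}$ for all $a,b\in S$. For $a,b,c\in S$: $a$ is left $(b,c)$-invertible if $b\in Scab$, and right $(b,c)$-invertible if $c\in cabS$. An element $a$ is left (resp. right) core invertible if it is left (resp. right) $(a,a^{*})$-invertible, that is, $a\in Sa^{*}a^{2}$ (resp. $a^{*}\in a^{*}a^{2}S$). An element $a$ is Moore--Penrose invertible if there is $x\in S$ with $axa=a$, $xax=x$, $(ax)^{*}=ax$, $(xa)^{*}=xa$; such $x$ is unique and denoted $a^{\dag}$. An element $a$ is group invertible if there is $x\in S$ with $axa=a$, $xax=x$, $ax=xa$; such $x$ is unique and denoted $a^{\#}$. An element $a$ is EP if it is both Moore--Penrose invertible and group invertible and $a^{\dag}=a^{\#}$. *)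

theory Defs
  imports Main
begin

class star_monoid = monoid_mult +
  fixes star :: "'a \<Rightarrow> 'a"  ("(_\<^sup>\<star>)" [1000] 999)
  assumes star_star: "(a\<^sup>\<star>)\<^sup>\<star> = a"
    and star_mult: "(a * b)\<^sup>\<star> = b\<^sup>\<star> * a\<^sup>\<star>"

text \<open>Argument order: \<open>left_bc_invertible b c a\<close> says that \<open>a\<close> is left \<open>(b,c)\<close>-invertible.\<close>

definition left_bc_invertible :: "'a::monoid_mult \<Rightarrow> 'a \<Rightarrow> 'a \<Rightarrow> bool" where
  "left_bc_invertible b c a \<longleftrightarrow> b \<in> {s * c * a * b | s. True}"

definition right_bc_invertible :: "'a::monoid_mult \<Rightarrow> 'a \<Rightarrow> 'a \<Rightarrow> bool" where
  "right_bc_invertible b c a \<longleftrightarrow> c \<in> {c * a * b * s | s. True}"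

definition left_core_invertible :: "'a::star_monoid \<Rightarrow> bool" where
  "left_core_invertible a \<longleftrightarrow> left_bc_invertible a (a\<^sup>\<star>) a"

definition right_core_invertible :: "'a::star_monoid \<Rightarrow> bool" where
  "right_core_invertible a \<longleftrightarrow> right_bc_invertible a (a\<^sup>\<star>) a"

definition is_mp_inverse :: "'a::star_monoid \<Rightarrow> 'a \<Rightarrow> bool" where
  "is_mp_inverse a x \<longleftrightarrow>
     a * x * a = a \<and> x * a * x = x \<and> (a * x)\<^sup>\<star> = a * x \<and> (x * a)\<^sup>\<star> = x * a"

definition mp_invertible :: "'a::star_monoid \<Rightarrow> bool" where
  "mp_invertible a \<longleftrightarrow> (\<exists>x. is_mp_inverse a x)"

text \<open>The description is meaningful only for Moore--Penrose invertible \<open>a\<close>; likewise for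
  \<open>group_inverse\<close> below. Uniqueness is \<open>is_mp_inverse_unique\<close> and \<open>is_group_inverse_unique\<close>.\<close>

definition mp_inverse :: "'a::star_monoid \<Rightarrow> 'a" where
  "mp_inverse a = (THE x. is_mp_inverse a x)"

definition is_group_inverse :: "'a::monoid_mult \<Rightarrow> 'a \<Rightarrow> bool" where
  "is_group_inverse a x \<longleftrightarrow> a * x * a = a \<and> x * a * x = x \<and> a * x = x * a"

definition group_invertible :: "'a::monoid_mult \<Rightarrow> bool" where
  "group_invertible a \<longleftrightarrow> (\<exists>x. is_group_inverse a x)"

definition group_inverse :: "'a::monoid_mult \<Rightarrow> 'a" where
  "group_inverse a = (THE x. is_group_inverse a x)"

definition EP :: "'a::star_monoid \<Rightarrow> bool" where
  "EP a \<longleftrightarrow> mp_invertible a \<and> group_invertible a \<and> mp_inverse a = group_inverse a"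

lemma is_mp_inverse_unique:
  assumes x: "is_mp_inverse a x" and y: "is_mp_inverse a y"
  shows "x = y"
proof -
  have ax: "a * x = a * y"
  proof -
    have "a * x = (a * x)\<^sup>\<star>" using x by (simp add: is_mp_inverse_def)
    also have "\<dots> = ((a * y) * (a * x))\<^sup>\<star>"
      using y by (simp add: is_mp_inverse_def mult.assoc [symmetric])
    also have "\<dots> = (a * x) * (a * y)"
      using x y by (simp add: is_mp_inverse_def star_mult [of "a * y" "a * x"])
    also have "\<dots> = a * y"
      using x by (simp add: is_mp_inverse_def mult.assoc [symmetric])
    finally show ?thesis .
  qed
  have xa: "x * a = y * a"
  proof -
    have "x * a = (x * a)\<^sup>\<star>" using x by (simp add: is_mp_inverse_def)
    also have "\<dots> = ((x * a) * (y * a))\<^sup>\<star>"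
      using y by (simp add: is_mp_inverse_def mult.assoc)
    also have "\<dots> = (y * a) * (x * a)"
      using x y by (simp add: is_mp_inverse_def star_mult [of "x * a" "y * a"])
    also have "\<dots> = y * a"
      using x by (simp add: is_mp_inverse_def mult.assoc)
    finally show ?thesis .
  qed
  have "x = x * a * x" using x by (simp add: is_mp_inverse_def)
  also have "\<dots> = y * a * y" using ax xa by (simp add: mult.assoc)
  also have "\<dots> = y" using y by (simp add: is_mp_inverse_def)
  finally show ?thesis .
qed

lemma is_group_inverse_unique:
  assumes x: "is_group_inverse a x" and y: "is_group_inverse a y"
  shows "x = y"
proof -
  have x1: "a * x * a = a" and x2: "x * a * x = x" and x3: "a * x = x * a"
    using x unfolding is_group_inverse_def by blast+
  have y1: "a * y * a = a" and y2: "y * a * y = y" and y3: "a * y = y * a"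
    using y unfolding is_group_inverse_def by blast+
  have "a * x = a * y * a * x" by (simp only: y1)
  also have "\<dots> = y * a * (a * x)" by (simp only: y3 mult.assoc)
  also have "\<dots> = y * a * (x * a)" by (simp only: x3)
  also have "\<dots> = y * (a * x * a)" by (simp only: mult.assoc)
  also have "\<dots> = y * a" by (simp only: x1)
  finally have e: "a * x = y * a" .
  have "x = x * a * x" by (simp only: x2)
  also have "\<dots> = a * x * x" by (simp only: x3)
  also have "\<dots> = y * (a * x)" by (simp only: e mult.assoc)
  also have "\<dots> = y * (a * y)" by (simp only: e y3)
  also have "\<dots> = y" using y2 by (simp only: mult.assoc)
  finally show ?thesis .
qed

end

theory Submission
  imports Defs
begin

text \<open>Since \<open>a\<^sup>2\<close> is self-adjoint, right core invertibility means \<open>a = u a\<^sup>3\<close> for some \<open>u\<close>. Then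
  \<open>p = u a\<^sup>2\<close> satisfies \<open>p p\<^sup>\<star> = p\<^sup>\<star>\<close>, so it is a projection; it is a two-sided unit for \<open>a\<close>, and
  \<open>p = u a\<^sup>2 = a\<^sup>2 u\<^sup>\<star>\<close> makes \<open>a\<close> invertible in \<open>p S p\<close>, with inverse \<open>a u\<^sup>\<star>\<close>.\<close>

lemma left_core_invertible_iff:
  "left_core_invertible a \<longleftrightarrow> (\<exists>s. a = s * a\<^sup>\<star> * a * a)"
  by (auto simp: left_core_invertible_def left_bc_invertible_def)

lemma right_core_invertible_iff:
  fixes a :: "'a::star_monoid"
  assumes "(a * a)\<^sup>\<star> = a * a"
  shows "right_core_invertible a \<longleftrightarrow> (\<exists>u. a = u * a * a * a)"
proof -
  \<comment> \<open>The star is a bijection, so right multipliers \<open>s\<close> correspond to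
    left multipliers \<open>u = s\<^sup>\<star>\<close>.\<close>
  have "a\<^sup>\<star> = a\<^sup>\<star> * a * a * s \<longleftrightarrow> a = s\<^sup>\<star> * a * a * a" for s
  proof -
    have "(a\<^sup>\<star> * a * a * s)\<^sup>\<star> = s\<^sup>\<star> * (a * a)\<^sup>\<star> * a"
      by (simp add: star_mult star_star mult.assoc)
    then have "(a\<^sup>\<star> * a * a * s)\<^sup>\<star> = s\<^sup>\<star> * a * a * a"
      by (simp add: assms mult.assoc)
    then show ?thesis
      by (metis star_star)
  qed
  then show ?thesis
    unfolding right_core_invertible_def right_bc_invertible_def
    by (auto, metis star_star)
qed

text \<open>By uniqueness each description equals any witness, so one common inverse can replace the
  equation between them.\<close>

lemma EP_iff: "EP a \<longleftrightarrow> (\<exists>x. is_mp_inverse a x \<and> is_group_inverse a x)"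
proof -
  have mp: "mp_inverse a = x" if "is_mp_inverse a x" for x
    unfolding mp_inverse_def using that is_mp_inverse_unique by blast
  have "group_inverse a = x" if "is_group_inverse a x" for x
    unfolding group_inverse_def using that is_group_inverse_unique by blast
  with mp show ?thesis
    unfolding EP_def mp_invertible_def group_invertible_def by metis
qed

text \<open>Substituting the equation for \<open>a\<close> into the first factor of its own
  \<open>a * a\<close> raises the square to a cube.\<close>

lemma left_core_imp_cube:
  fixes a :: "'a::star_monoid"
  assumes "left_core_invertible a"
  shows "\<exists>u. a = u * a * a * a"
proof -
  obtain s where s: "a = s * a\<^sup>\<star> * a * a"
    using assms left_core_invertible_iff by blast
  then have "a = s * a\<^sup>\<star> * (s * a\<^sup>\<star> * a * a) * a"
    by simp
  then have "a = (s * a\<^sup>\<star> * s * a\<^sup>\<star>) * a * a * a"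
    by (simp add: mult.assoc)
  then show ?thesis ..
qed

lemma cube_imp_EP:
  fixes a :: "'a::star_monoid"
  assumes sa: "(a * a)\<^sup>\<star> = a * a" and u: "a = u * a * a * a"
  shows "EP a"
proof -
  define p where "p = u * a * a"
  define y where "y = a * u\<^sup>\<star>"
  have pa: "p * a = a"
    using u by (simp add: p_def)
  have p_star: "p\<^sup>\<star> = a * a * u\<^sup>\<star>"
    by (simp add: p_def star_mult [of "u * a"] star_mult [of u] sa [unfolded star_mult]
        mult.assoc [symmetric])
  have "p * p\<^sup>\<star> = p\<^sup>\<star>"
    by (simp add: p_star pa mult.assoc [symmetric])
  \<comment> \<open>\<open>p * p\<^sup>\<star>\<close> is self-adjoint, hence so is
    \<open>p\<^sup>\<star>\<close>.\<close>
  then have p_sa: "p\<^sup>\<star> = p"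
    by (metis star_mult star_star)
  \<comment> \<open>The aim is to write \<open>a\<^sup>\<star>\<close> with leftmost factor
    \<open>a\<close>, which \<open>p\<close> fixes; starring then gives
    \<open>a * p = a\<close>.\<close>
  have "a\<^sup>\<star> = a\<^sup>\<star> * a\<^sup>\<star> * (a\<^sup>\<star> * u\<^sup>\<star>)"
    using arg_cong [OF u, of star] by (simp add: star_mult mult.assoc)
  also have "\<dots> = a * a * (a\<^sup>\<star> * u\<^sup>\<star>)"
    using sa by (simp add: star_mult)
  finally have "p * a\<^sup>\<star> = a\<^sup>\<star>"
    by (metis pa mult.assoc)
  then have ap: "a * p = a"
    by (metis p_sa star_mult star_star)
  have ay: "a * y = p"
    using p_star p_sa by (simp add: y_def mult.assoc)
  have py: "p * y = y"
    by (simp add: y_def pa mult.assoc [symmetric])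
  \<comment> \<open>This form makes \<open>y * a\<close> equal to \<open>p * p\<close>. It comes
    from expanding the second \<open>p\<close> in \<open>y = p * p * y\<close>, then using
    \<open>a * y = p\<close> and \<open>a * p = a\<close>.\<close>
  have "y = p * u * a"
  proof -
    have "y = p * u * a * (a * y)"
      using p_sa py \<open>p * p\<^sup>\<star> = p\<^sup>\<star>\<close> by (metis p_def mult.assoc)
    then show ?thesis
      by (simp add: ay) (metis ap mult.assoc)
  qed
  then have ya: "y * a = p"
    using p_sa \<open>p * p\<^sup>\<star> = p\<^sup>\<star>\<close> by (metis p_def mult.assoc)
  show ?thesis
    unfolding EP_iff is_mp_inverse_def is_group_inverse_def
    using ay ya pa py p_sa by metis
qed

lemma EP_imp_left_core:
  fixes a :: "'a::star_monoid"
  assumes "EP a"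
  shows "left_core_invertible a"
proof -
  obtain x where x: "a * x * a = a" "(a * x)\<^sup>\<star> = a * x" "a * x = x * a"
    using assms unfolding EP_iff is_mp_inverse_def is_group_inverse_def by blast
  \<comment> \<open>This collapses the star factors for the left multiplier
    \<open>x * x\<^sup>\<star>\<close>; commutation then gives \<open>x * a * a = a\<close>.\<close>
  have "x\<^sup>\<star> * a\<^sup>\<star> = a * x"
    using x(2) by (simp add: star_mult)
  then have "(x * x\<^sup>\<star>) * a\<^sup>\<star> * a * a = x * (a * x * a) * a"
    by (metis mult.assoc)
  also have "\<dots> = a"
    using x by simp
  finally show ?thesis
    unfolding left_core_invertible_iff by metis
qed

theorem theorem3p9:
  fixes a :: "'a::star_monoid"
  assumes "(a ^ 2)\<^sup>\<star> = a ^ 2"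
  shows "(left_core_invertible a \<longleftrightarrow> right_core_invertible a) \<and>
         (right_core_invertible a \<longleftrightarrow> EP a)"
proof -
  have sa: "(a * a)\<^sup>\<star> = a * a"
    using assms by (simp add: power2_eq_square)
  show ?thesis
    \<comment> \<open>The cycle is left core, cube equation, EP, left core; right core is the cube
      equation itself.\<close>
    using right_core_invertible_iff [OF sa] left_core_imp_cube cube_imp_EP [OF sa]
      EP_imp_left_core by blast
qed

end
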